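(* There is an $O(1)$-competitive online algorithm for the hard $3$-taxi problem on the line; that is, there exist a constant $\rho$ and an online algorithm for the hard $3$-taxi problem on the metric space $\mathbb{R}$ with $d(x,y)=|x-y|$ that is $\rho$-competitive.
   Context: **Hard $k$-taxi problem** (here $k=3$). Let $(M,d)$ be a metric space. A configuration is a multiset of $k$ points of $M$ (the taxi positions). Given an initial configuration and a sequence of requests $\sigma=(r_1,\dots,r_n)$ with $r_i=(s_i,t_i)\in M^2$, an algorithm must move the taxis so as to serve the requests in order; a taxi serves $r_i$ by first moving to $s_i$ and then to $t_i$. The cost is the total distance travelled by all taxis, except that the movement of the serving taxi from $s_i$ to $t_i$ is not counted. An online algorithm must serve each request without knowledge of future requests. **Competitiveness.** An online algorithm $A$ is $\rho$-competitive if $E(\mathrm{cost}_A(\sigma))\le \rho\,\mathrm{OPT}(\sigma)+c$ for every request sequence $\sigma$ (the expectation is superfluous for deterministic algorithms), where $\mathrm{OPT}(\sigma)$ is the optimal offline cost of serving $\sigma$ from the same initial configuration and $c$ is a constant independent of $\sigma$. *)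

theory Defs
  imports "HOL-Probability.Probability" "HOL-Library.Multiset"
begin

type_synonym 'a config = "'a multiset"
type_synonym 'a request = "'a \<times> 'a"

text \<open>
  A move describes everything the taxis do on account of one request \<open>(s, t)\<close>. If the field
  \<open>serving\<close> is \<open>(x, y)\<close>, then the serving taxi travels from \<open>x\<close> to \<open>s\<close>, carries the passenger
  to \<open>t\<close>, and then travels on to \<open>y\<close> (it stays at the drop-off point if \<open>y = t\<close>). A pair
  \<open>(p, q)\<close> in \<open>others\<close> is a taxi that travels from \<open>p\<close> to \<open>q\<close> without serving the request
  (it does not move if \<open>p = q\<close>). Thus every move starting in the current configuration
  serves the request, whatever the request is.
\<close>

datatype 'a move = Move (serving: "'a \<times> 'a") (others: "('a \<times> 'a) multiset")

definition config_before :: "'a move \<Rightarrow> 'a config" where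
  "config_before m = add_mset (fst (serving m)) (image_mset fst (others m))"

definition config_after :: "'a move \<Rightarrow> 'a config" where
  "config_after m = add_mset (snd (serving m)) (image_mset snd (others m))"

text \<open>The passenger ride from \<open>s\<close> to \<open>t\<close> is free.\<close>

definition move_cost :: "'a::metric_space request \<Rightarrow> 'a move \<Rightarrow> real" where
  "move_cost r m =
     dist (fst (serving m)) (fst r) + dist (snd r) (snd (serving m))
     + (\<Sum>(p, q)\<in>#others m. dist p q)"

fun serves :: "'a config \<Rightarrow> 'a request list \<Rightarrow> 'a move list \<Rightarrow> bool" where
  "serves C [] [] \<longleftrightarrow> True"
| "serves C (r # rs) (m # ms) \<longleftrightarrow> config_before m = C \<and> serves (config_after m) rs ms"
| "serves C _ _ \<longleftrightarrow> False"

definition total_cost :: "'a::metric_space request list \<Rightarrow> 'a move list \<Rightarrow> real" where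
  "total_cost \<sigma> ms = (\<Sum>(r, m)\<leftarrow>zip \<sigma> ms. move_cost r m)"

definition OPT :: "'a::metric_space config \<Rightarrow> 'a request list \<Rightarrow> real" where
  "OPT C \<sigma> = (INF ms \<in> {ms. serves C \<sigma> ms}. total_cost \<sigma> ms)"

text \<open>
  A deterministic strategy maps the initial configuration and the requests revealed so far
  (the last of which is the one to be served now) to the next move. Its own earlier moves are
  determined by these data.
\<close>

type_synonym 'a strategy = "'a config \<Rightarrow> 'a request list \<Rightarrow> 'a move"

definition strategy_moves :: "'a strategy \<Rightarrow> 'a config \<Rightarrow> 'a request list \<Rightarrow> 'a move list" where
  "strategy_moves A C \<sigma> = map (\<lambda>i. A C (take (Suc i) \<sigma>)) [0..<length \<sigma>]"

definition deterministic_online_algorithm :: "nat \<Rightarrow> 'a strategy \<Rightarrow> bool" where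
  "deterministic_online_algorithm k A \<longleftrightarrow>
     (\<forall>C \<sigma>. size C = k \<longrightarrow> serves C \<sigma> (strategy_moves A C \<sigma>))"

definition strategy_cost :: "'a::metric_space strategy \<Rightarrow> 'a config \<Rightarrow> 'a request list \<Rightarrow> real" where
  "strategy_cost A C \<sigma> = total_cost \<sigma> (strategy_moves A C \<sigma>)"

text \<open>
  An online algorithm may be randomized: it is a probability distribution over deterministic
  online algorithms. The sigma-algebra is arbitrary as long as all costs are random variables.
  Deterministic algorithms are the point masses.
\<close>

definition online_algorithm :: "nat \<Rightarrow> 'a::metric_space strategy measure \<Rightarrow> bool" where
  "online_algorithm k \<A> \<longleftrightarrow>
     prob_space \<A> \<and>
     (\<forall>A\<in>space \<A>. deterministic_online_algorithm k A) \<and>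
     (\<forall>C \<sigma>. size C = k \<longrightarrow> (\<lambda>A. strategy_cost A C \<sigma>) \<in> borel_measurable \<A>)"

text \<open>
  The adversary is oblivious: the request sequence is fixed before the random choice.
  The additive constant may depend on the initial configuration, but not on the requests.
  Integrability expresses that the expected cost is finite.
\<close>

definition competitive :: "nat \<Rightarrow> real \<Rightarrow> 'a::metric_space strategy measure \<Rightarrow> bool" where
  "competitive k \<rho> \<A> \<longleftrightarrow>
     (\<forall>C. size C = k \<longrightarrow>
       (\<exists>c::real. \<forall>\<sigma>.
          integrable \<A> (\<lambda>A. strategy_cost A C \<sigma>) \<and>
          (\<integral>A. strategy_cost A C \<sigma> \<partial>\<A>) \<le> \<rho> * OPT C \<sigma> + c))"

end

theory Submission imports Defs begin

text \<open>
  Only the triangle inequality is needed, so everything is done in an arbitrary metric space.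
  The algorithm keeps its taxis as a triple \<open>(t, z, x)\<close>: \<open>t\<close> is the last drop-off point, where
  the offline algorithm also has a taxi, \<open>z\<close> is a point where an offline taxi is believed to be,
  and nothing is known about \<open>x\<close>. On a request at \<open>s\<close> it first draws the new belief
  among \<open>t\<close> and \<open>z\<close>, preferring the one farther from \<open>s\<close>, and then serves either with
  \<open>x\<close>, with a probability of order \<open>m / (m + dist x s)\<close> where \<open>m\<close> is the distance from \<open>s\<close> to the
  nearer of \<open>t\<close> and \<open>z\<close>, or with the one of \<open>t\<close> and \<open>z\<close> that is not believed.

  If the other two offline taxis are at \<open>q\<close> and \<open>q'\<close>, the potential combines the cost of matching
  \<open>{z, x}\<close> to \<open>{q, q'}\<close> with a large multiple of the distance from \<open>z\<close> to \<open>{q, q'}\<close>. If the offline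
  algorithm serves from \<open>t\<close>, it pays \<open>dist t s\<close>, which covers the expected cost and
  potential increase. If it serves without cost from \<open>q = s\<close>, the expected potential decreases
  enough: either the belief is wrong by at least a constant fraction of \<open>dist z s\<close>, and it
  improves by order \<open>m\<close> in expectation, or it is nearly right, so that \<open>x\<close> is the taxi that
  should serve and the matching improves.
\<close>

section \<open>The two coin probabilities\<close>

definition mix :: "real \<Rightarrow> real \<Rightarrow> real \<Rightarrow> real" where
  "mix p v w = p * v + (1 - p) * w"

lemma mix_mono:
  assumes "0 \<le> p" "p \<le> 1" "v \<le> v'" "w \<le> w'"
  shows "mix p v w \<le> mix p v' w'"
  unfolding mix_def using assms by (intro add_mono mult_left_mono) auto

lemma mix_add: "mix p (v + c) (w + c) = mix p v w + c"
  by (simp add: mix_def algebra_simps)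

text \<open>Chance of moving the belief to \<open>t\<close>, with \<open>a = dist t s\<close> and
  \<open>D = dist z s\<close>. The factor 2 makes it reach 1 at \<open>a = D\<close>.\<close>

definition belief_prob :: "real \<Rightarrow> real \<Rightarrow> real" where
  "belief_prob a D = min 1 (2 * a / (a + D))"

text \<open>When an idle offline taxi is at \<open>s\<close>, serving without \<open>x\<close> loses
  at most five times the distance driven, which has mean at most \<open>3 * m\<close>; hence
  \<open>15 = 5 * 3\<close>.\<close>

definition explore_prob :: "real \<Rightarrow> real \<Rightarrow> real" where
  "explore_prob m b = min 1 (15 * m / (m + b))"

text \<open>For \<open>a = D = 0\<close> the quotient is \<open>0\<close> by convention, and the bounds still hold.\<close>

lemma belief_prob_bounds:
  assumes "0 \<le> a" "0 \<le> D"
  shows "0 \<le> belief_prob a D" "belief_prob a D \<le> 1"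
    "(1 - belief_prob a D) * (a + D) = D - min a D"
    "belief_prob a D * D \<le> 2 * min a D"
    "min a D \<le> belief_prob a D * D"
    "belief_prob a D * (a + D) \<le> 2 * a"
    "(1 - belief_prob a D) * a \<le> min a D"
proof -
  consider "a = 0" "D = 0" | "a + D > 0" "D \<le> a" | "a + D > 0" "a < D"
    using assms by fastforce
  then have "0 \<le> belief_prob a D \<and> belief_prob a D \<le> 1 \<and>
    (1 - belief_prob a D) * (a + D) = D - min a D \<and>
    belief_prob a D * D \<le> 2 * min a D \<and>
    min a D \<le> belief_prob a D * D \<and>
    belief_prob a D * (a + D) \<le> 2 * a \<and>
    (1 - belief_prob a D) * a \<le> min a D"
  proof cases
    case 1
    then show ?thesis by (simp add: belief_prob_def)
  next
    case 2
    then have "belief_prob a D = 1"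
      by (simp add: belief_prob_def field_simps)
    then show ?thesis using 2 assms by simp
  next
    case 3
    then have eq: "belief_prob a D = 2 * a / (a + D)"
      by (simp add: belief_prob_def min_def field_simps)
    have "a * a \<le> a * D" using 3 assms by (simp add: mult_left_mono)
    then show ?thesis using 3 assms unfolding eq
      by (auto simp: field_simps)
  qed
  then show "0 \<le> belief_prob a D" "belief_prob a D \<le> 1"
    "(1 - belief_prob a D) * (a + D) = D - min a D"
    "belief_prob a D * D \<le> 2 * min a D"
    "min a D \<le> belief_prob a D * D"
    "belief_prob a D * (a + D) \<le> 2 * a"
    "(1 - belief_prob a D) * a \<le> min a D"
    by auto
qed

lemma explore_prob_bounds:
  assumes "0 \<le> m" "0 \<le> b"
  shows "0 \<le> explore_prob m b" "explore_prob m b \<le> 1"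
    "explore_prob m b * (m + b) \<le> 15 * m"
    "15 * (1 - explore_prob m b) * m \<le> explore_prob m b * b"
proof -
  consider "m = 0" "b = 0" | "m + b > 0" "b \<le> 14 * m" | "m + b > 0" "14 * m < b"
    using assms by fastforce
  then have "0 \<le> explore_prob m b \<and> explore_prob m b \<le> 1 \<and>
    explore_prob m b * (m + b) \<le> 15 * m \<and>
    15 * (1 - explore_prob m b) * m \<le> explore_prob m b * b"
  proof cases
    case 1
    then show ?thesis by (simp add: explore_prob_def)
  next
    case 2
    then have "explore_prob m b = 1"
      by (simp add: explore_prob_def field_simps)
    then show ?thesis using 2 assms by simp
  next
    case 3
    then have eq: "explore_prob m b = 15 * m / (m + b)"
      by (simp add: explore_prob_def min_def field_simps)
    show ?thesis using 3 assms unfolding eq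
      by (auto simp: field_simps)
  qed
  then show "0 \<le> explore_prob m b" "explore_prob m b \<le> 1"
    "explore_prob m b * (m + b) \<le> 15 * m"
    "15 * (1 - explore_prob m b) * m \<le> explore_prob m b * b"
    by auto
qed

lemma explore_prob_near:
  assumes "0 \<le> m" "0 \<le> b" "m \<le> a"
  shows "explore_prob m b * (a + b) \<le> 15 * a"
proof -
  have "explore_prob m b * (a - m) \<le> 1 * (a - m)"
    using assms explore_prob_bounds(2)[of m b] by (intro mult_right_mono) auto
  then show ?thesis
    using explore_prob_bounds(3)[of m b] assms by (simp add: algebra_simps)
qed

section \<open>The potential and its expected change in one step\<close>

definition matching :: "'a::metric_space \<Rightarrow> 'a \<Rightarrow> 'a \<Rightarrow> 'a \<Rightarrow> real" where
  "matching z x q q' = min (dist z q + dist x q') (dist z q' + dist x q)"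

definition belief_error :: "'a::metric_space \<Rightarrow> 'a \<Rightarrow> 'a \<Rightarrow> real" where
  "belief_error z q q' = min (dist z q) (dist z q')"

text \<open>In \<open>drift_inequality\<close>, weight 4 lets a matching gain of
  \<open>b / 2\<close> pay for travel \<open>b\<close> and leave \<open>b\<close>; weight
  \<open>720 = 8 * 90\<close> lets a belief gain of \<open>m / 8\<close> pay for a rise of
  \<open>90 * m\<close>.\<close>

definition potential :: "'a::metric_space \<Rightarrow> 'a \<Rightarrow> 'a \<Rightarrow> 'a \<Rightarrow> real" where
  "potential z x q q' = 4 * matching z x q q' + 720 * belief_error z q q'"

lemma potential_nonneg: "0 \<le> potential z x q q'"
  by (simp add: potential_def matching_def belief_error_def)

lemma potential_commute: "potential z x q q' = potential z x q' q"
  by (simp add: potential_def matching_def belief_error_def min.commute)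

text \<open>Both summands are 1-Lipschitz in the offline movement, and
  \<open>724 = 4 + 720\<close>.\<close>

lemma potential_lipschitz:
  "potential z x q q' \<le> potential z x p p' + 724 * (dist p q + dist p' q')"
proof -
  have "dist z q \<le> dist z p + dist p q" "dist x q \<le> dist x p + dist p q"
    "dist z q' \<le> dist z p' + dist p' q'" "dist x q' \<le> dist x p' + dist p' q'"
    by (auto intro: dist_triangle)
  moreover have "0 \<le> dist p q" "0 \<le> dist p' q'" by auto
  ultimately have "matching z x q q' \<le> matching z x p p' + (dist p q + dist p' q')"
    "belief_error z q q' \<le> belief_error z p p' + (dist p q + dist p' q')"
    unfolding matching_def belief_error_def by linarith+
  then show ?thesis unfolding potential_def by argo
qed

text \<open>
  The expected cost of serving a request at \<open>s\<close> plus the potential afterwards, if the offline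
  taxis that do not serve end up at \<open>q\<close> and \<open>q'\<close>.
\<close>

definition expected_step :: "'a::metric_space \<Rightarrow> 'a \<Rightarrow> 'a \<Rightarrow> 'a \<Rightarrow> 'a \<Rightarrow> 'a \<Rightarrow> real" where
  "expected_step t z x s q q' =
    (let a = dist t s; D = dist z s; b = dist x s; p = explore_prob (min a D) b in
     mix (belief_prob a D)
       (mix p (b + potential t z q q') (D + potential t x q q'))
       (mix p (b + potential z t q q') (a + potential z x q q')))"

lemma expected_step_lipschitz:
  "expected_step t z x s q q' \<le> expected_step t z x s p p' + 724 * (dist p q + dist p' q')"
proof -
  let ?c = "724 * (dist p q + dist p' q')"
  have *: "c + potential z' x' q q' \<le> (c + potential z' x' p p') + ?c" for c z' x'
    using potential_lipschitz[of z' x' q q' p p'] by simp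
  show ?thesis
    unfolding expected_step_def Let_def mix_add[symmetric]
    by (intro mix_mono * belief_prob_bounds explore_prob_bounds) auto
qed

text \<open>For an offline taxi serving from \<open>t\<close>. Outcomes at scale
  \<open>a + b\<close> or \<open>a + D\<close> have probability of order \<open>a\<close> over that
  scale, so each contributes O(\<open>a\<close>).\<close>

lemma expected_step_last:
  "expected_step t z x s q q' \<le> potential z x q q' + 2000 * dist t s"
proof -
  define a D b where "a = dist t s" and "D = dist z s" and "b = dist x s"
  define \<beta> p where "\<beta> = belief_prob a D" and "p = explore_prob (min a D) b"
  define \<Phi> where "\<Phi> = potential z x q q'"
  have nn: "0 \<le> a" "0 \<le> D" "0 \<le> b" by (auto simp: a_def D_def b_def)
  note \<beta> = belief_prob_bounds[OF nn(1,2), folded \<beta>_def]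
  have m: "0 \<le> min a D" using nn by simp
  note p = explore_prob_bounds[OF m nn(3), folded p_def]
    explore_prob_near[OF m nn(3), of a, folded p_def]
  have zt: "dist z t \<le> a + D" unfolding a_def D_def
    by (metis add.commute dist_commute dist_triangle)
  have xt: "dist x t \<le> a + b" unfolding a_def b_def
    by (metis add.commute dist_commute dist_triangle)
  have tq: "dist t q \<le> dist z q + dist z t" "dist t q' \<le> dist z q' + dist z t"
    "dist t q \<le> dist x q + dist x t" "dist t q' \<le> dist x q' + dist x t"
    by (metis add.commute dist_commute dist_triangle)+
  have M: "matching t z q q' \<le> matching z x q q' + (a + b)"
    "matching z t q q' \<le> matching z x q q' + (a + b)"
    "matching t x q q' \<le> matching z x q q' + (a + D)"
    "belief_error t q q' \<le> belief_error z q q' + (a + D)"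
    unfolding matching_def belief_error_def using tq zt xt by linarith+
  have P: "potential t z q q' \<le> \<Phi> + 4 * (a + b) + 720 * (a + D)"
    "potential z t q q' \<le> \<Phi> + 4 * (a + b)"
    "potential t x q q' \<le> \<Phi> + 4 * (a + D) + 720 * (a + D)"
    unfolding \<Phi>_def potential_def using M by argo+
  have "expected_step t z x s q q' \<le>
     mix \<beta>
       (mix p (b + (\<Phi> + 4 * (a + b) + 720 * (a + D))) (D + (\<Phi> + 4 * (a + D) + 720 * (a + D))))
       (mix p (b + (\<Phi> + 4 * (a + b))) (a + \<Phi>))"
    unfolding expected_step_def Let_def
    unfolding a_def[symmetric] D_def[symmetric] b_def[symmetric]
    unfolding \<beta>_def[symmetric] p_def[symmetric] \<Phi>_def[symmetric]
    by (intro mix_mono add_left_mono P \<beta>(1,2) p(1,2) order_refl)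
  also have "\<dots> = \<Phi> + p * (b + 4 * (a + b))
      + (1 - p) * (\<beta> * (D + 4 * (a + D)) + (1 - \<beta>) * a) + 720 * (\<beta> * (a + D))"
    unfolding mix_def by algebra
  \<comment> \<open>\<open>75 = 5 * 15\<close> bounds exploring, \<open>11 = 5 * 2 + 1\<close>
    serving without \<open>x\<close>, \<open>1440 = 720 * 2\<close> the belief error. The sum 1526
    is rounded up to 2000.\<close>
  also have "\<dots> \<le> \<Phi> + 75 * a + 11 * a + 1440 * a"
  proof -
    have "p * (b + 4 * (a + b)) \<le> p * (5 * (a + b))"
      using nn p by (intro mult_left_mono) auto
    also have "\<dots> \<le> 75 * a" using p(5) by (simp add: algebra_simps)
    finally have 1: "p * (b + 4 * (a + b)) \<le> 75 * a" .
    have "\<beta> * (D + 4 * (a + D)) \<le> \<beta> * (5 * (a + D))"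
      using nn \<beta> by (intro mult_left_mono) auto
    also have "\<dots> \<le> 10 * a" using \<beta>(6) by (simp add: algebra_simps)
    finally have 2: "\<beta> * (D + 4 * (a + D)) + (1 - \<beta>) * a \<le> 11 * a"
      using \<beta>(7) by linarith
    have "(1 - p) * (\<beta> * (D + 4 * (a + D)) + (1 - \<beta>) * a) \<le> (1 - p) * (11 * a)"
      using p 2 by (intro mult_left_mono) auto
    also have "\<dots> \<le> 1 * (11 * a)" using p nn by (intro mult_right_mono) auto
    finally show ?thesis using 1 \<beta>(6) by linarith
  qed
  finally show ?thesis using nn unfolding \<Phi>_def a_def by linarith
qed

text \<open>
  Here \<open>e = dist z q\<close> and \<open>f = dist x q\<close>, where the offline taxis are at \<open>t\<close>, \<open>s\<close> and \<open>q\<close>.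
\<close>

lemma drift_inequality:
  fixes a b D e f p \<beta> M m :: real
  assumes nn: "0 \<le> a" "0 \<le> b" "0 \<le> D" "0 \<le> e" "0 \<le> f"
    and m: "m = min a D" and \<beta>: "\<beta> = belief_prob a D" and p: "p = explore_prob m b"
    and M: "M = min (D + f) (e + b)"
    and quad: "b \<le> f + D + e" "e \<le> D + b + f" "f \<le> D + b + e"
  shows "p * (b + 4 * e) + (1 - p) * (4 * M + 15 * m) + 720 * ((1 - \<beta>) * min (a + D) e)
    \<le> 4 * M + 720 * min D e"
proof -
  note \<beta>' = belief_prob_bounds[OF nn(1,3), folded \<beta> m]
  have m0: "0 \<le> m" using nn m by simp
  note p' = explore_prob_bounds[OF m0 nn(2), folded p]
  have pb: "p * b \<le> 15 * m" using p'(3) mult_nonneg_nonneg[OF p'(1) m0] 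
    by (simp add: algebra_simps)
  have pm: "(1 - p) * m \<le> m" using mult_nonneg_nonneg[OF p'(1) m0]
    by (simp add: algebra_simps)
  have "p * (e - M) \<le> p * b"
    using quad nn M p'(1) by (intro mult_left_mono) linarith+
  \<comment> \<open>As \<open>e - M \<le> b\<close>, exploring adds at most
    \<open>5 * p * b \<le> 75 * m\<close>, the other branch at most \<open>15 * m\<close>.\<close>
  then have crude: "p * (b + 4 * e) + (1 - p) * (4 * M + 15 * m) \<le> 4 * M + 90 * m"
    using pb pm by (simp add: algebra_simps)
  have \<beta>e: "(1 - \<beta>) * min (a + D) e \<le> (1 - \<beta>) * e"
    using \<beta>'(2) by (intro mult_left_mono) auto
  have \<beta>aD: "(1 - \<beta>) * min (a + D) e \<le> (1 - \<beta>) * (a + D)"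
    using \<beta>'(2) by (intro mult_left_mono) auto
  consider "D \<le> e" | "e < D" "D \<le> 8 * e" | "8 * e < D" "e < D" by linarith
  then show ?thesis
  proof cases
    \<comment> \<open>The expected belief error falls from \<open>D\<close> to at most
      \<open>D - m\<close>.\<close>
    case 1
    then show ?thesis using crude \<beta>aD \<beta>'(3) m0 by simp
  next
    \<comment> \<open>Switching to \<open>t\<close> makes the belief error zero, a mean gain of
      \<open>\<beta> * e \<ge> m / 8\<close>.\<close>
    case 2
    have "\<beta> * D \<le> \<beta> * (8 * e)" using 2 \<beta>' by (intro mult_left_mono) auto
    then have "m \<le> 8 * (\<beta> * e)" using \<beta>'(5) by simp
    then show ?thesis using 2 crude \<beta>e by (simp add: algebra_simps)
  next
    \<comment> \<open>The belief is nearly right: exploring lowers the matching by at least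
      \<open>b / 2\<close>, which pays for its travel and for the \<open>15 * m\<close> of the other
      branch.\<close>
    case 3
    have "b / 2 \<le> M - e"
      using 3 quad nn unfolding M by (simp add: min_def)
    then have "p * (b + 4 * (e - M)) \<le> p * (- b)"
      using p' by (intro mult_left_mono) auto
    then have "p * (b + 4 * e) + (1 - p) * (4 * M + 15 * m) \<le> 4 * M"
      using p'(4) by (simp add: algebra_simps)
    moreover have "(1 - \<beta>) * e \<le> e" using \<beta>' nn by (simp add: algebra_simps)
    ultimately show ?thesis using 3 \<beta>e by simp
  qed
qed

text \<open>The offline algorithm pays nothing: its taxi at \<open>s\<close> serves and the one at
  \<open>t\<close> becomes idle, so the idle pair changes from \<open>s\<close>, \<open>q\<close> to
  \<open>t\<close>, \<open>q\<close>.\<close>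

lemma expected_step_other:
  "expected_step t z x s t q \<le> potential z x s q"
proof -
  define a D b e f where "a = dist t s" and "D = dist z s" and "b = dist x s"
    and "e = dist z q" and "f = dist x q"
  define \<beta> m p where "\<beta> = belief_prob a D" and "m = min a D" and "p = explore_prob m b"
  define M where "M = min (D + f) (e + b)"
  define E where "E = min (a + D) e"
  have nn: "0 \<le> a" "0 \<le> D" "0 \<le> b" "0 \<le> e" "0 \<le> f"
    by (auto simp: a_def D_def b_def e_def f_def)
  note \<beta> = belief_prob_bounds[OF nn(1,2), folded \<beta>_def m_def]
  have m: "0 \<le> m" using nn by (simp add: m_def)
  note p = explore_prob_bounds[OF m nn(3), folded p_def]
  have quad: "b \<le> f + D + e" "e \<le> D + b + f" "f \<le> D + b + e"
    unfolding D_def b_def e_def f_def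
    using dist_triangle[of x s q] dist_triangle[of q s z]
      dist_triangle[of z q s] dist_triangle[of s q x]
      dist_triangle[of x q s] dist_triangle[of s q z]
    by (simp_all add: dist_commute)
  have zt: "dist z t \<le> a + D" unfolding a_def D_def
    by (metis add.commute dist_commute dist_triangle)
  have xt: "dist x t \<le> a + b" unfolding a_def b_def
    by (metis add.commute dist_commute dist_triangle)
  have M1: "matching t z t q \<le> e" "matching z t t q \<le> e"
    by (simp_all add: matching_def e_def)
  have M2: "matching t x t q \<le> M + D" "matching z x t q \<le> M + a"
    using zt xt nn quad unfolding matching_def M_def e_def[symmetric] f_def[symmetric]
    by (auto simp: min_def)
  have E: "belief_error t t q = 0" "belief_error z t q \<le> E"
    using zt by (auto simp: belief_error_def E_def e_def)
  have P: "potential t z t q \<le> 4 * e" "potential t x t q \<le> 4 * (M + D)"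
    "potential z t t q \<le> 4 * e + 720 * E" "potential z x t q \<le> 4 * (M + a) + 720 * E"
    unfolding potential_def E(1) using M1 M2 E(2) by auto
  have "expected_step t z x s t q \<le>
     mix \<beta> (mix p (b + 4 * e) (D + 4 * (M + D)))
       (mix p (b + (4 * e + 720 * E)) (a + (4 * (M + a) + 720 * E)))"
    unfolding expected_step_def Let_def
    unfolding a_def[symmetric] D_def[symmetric] b_def[symmetric]
    unfolding m_def[symmetric] \<beta>_def[symmetric] p_def[symmetric]
    by (intro mix_mono add_left_mono P \<beta>(1,2) p(1,2))
  also have "\<dots> = p * (b + 4 * e) + (1 - p) * (4 * M + 5 * (\<beta> * D + (1 - \<beta>) * a))
      + 720 * ((1 - \<beta>) * E)"
    unfolding mix_def by algebra
  \<comment> \<open>The factor 5 is travel plus four times the matching increase;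
    \<open>\<beta> * D + (1 - \<beta>) * a \<le> 2 * m + m\<close>.\<close>
  also have "\<dots> \<le> p * (b + 4 * e) + (1 - p) * (4 * M + 15 * m) + 720 * ((1 - \<beta>) * E)"
    using \<beta>(4,7) p(2) by (intro add_mono mult_left_mono order_refl) auto
  also have "\<dots> \<le> 4 * M + 720 * min D e"
    unfolding E_def
    by (rule drift_inequality[OF nn(1,3,2,4,5) m_def \<beta>_def p_def M_def quad])
  also have "\<dots> = potential z x s q"
    by (simp add: potential_def matching_def belief_error_def M_def D_def e_def f_def b_def)
  finally show ?thesis .
qed

lemma mset_three_eq:
  assumes "{#x, p, p'#} = {#y, q, q'#}"
  shows "x = y \<and> (p = q \<and> p' = q' \<or> p = q' \<and> p' = q) \<or>
    (\<exists>c. (x = q \<and> c = q' \<or> x = q' \<and> c = q) \<and> (p = y \<and> p' = c \<or> p = c \<and> p' = y))"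
  using assms by (auto simp: add_eq_conv_ex)

lemma offline_step:
  assumes "{#c, p1, p2#} = {#y, q1, q2#}"
  shows "expected_step t z x s p1' p2' \<le>
    potential z x q1 q2 + 2000 * (dist t y + dist c s + dist p1 p1' + dist p2 p2')"
proof -
  have stay: ?thesis if "c = y" "{p1, p2} = {q1, q2}" "potential z x p1 p2 = potential z x q1 q2"
  proof -
    have "dist t s \<le> dist t y + dist c s" using that by (simp add: dist_triangle)
    then show ?thesis
      using expected_step_lipschitz[of t z x s p1' p2' p1 p2] expected_step_last[of t z x s p1 p2] that
      by (smt (verit) zero_le_dist)
  qed
  have sym: "expected_step t z x s p q = expected_step t z x s q p" for p q
    by (simp add: expected_step_def potential_commute[of _ _ p q])
  \<comment> \<open>An idle offline taxi takes over: it first moves from \<open>c\<close> to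
    \<open>s\<close>, then serves for free, and then the taxi at \<open>y\<close> moves as if from
    \<open>t\<close>.\<close>
  have switch: "expected_step t z x s p' c' \<le>
      potential z x c d + 2000 * (dist t y + dist c s + dist y p' + dist d c')" for p' c' d
  proof -
    have "dist t p' \<le> dist t y + dist y p'" by (rule dist_triangle)
    then show ?thesis
      using expected_step_lipschitz[of t z x s p' c' t d] expected_step_other[of t z x s d]
        potential_lipschitz[of z x s d c d]
      by (smt (verit) zero_le_dist dist_self)
  qed
  from mset_three_eq[OF assms] consider
    "c = y" "p1 = q1" "p2 = q2" | "c = y" "p1 = q2" "p2 = q1" |
    d where "c = q1 \<and> d = q2 \<or> c = q2 \<and> d = q1" "p1 = y" "p2 = d" |
    d where "c = q1 \<and> d = q2 \<or> c = q2 \<and> d = q1" "p1 = d" "p2 = y"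
    by blast
  then show ?thesis
  proof cases
    case 1
    then show ?thesis using stay by simp
  next
    case 2
    then show ?thesis using stay potential_commute[of z x q2 q1] by auto
  next
    case 3
    then have "potential z x c d = potential z x q1 q2" using potential_commute by metis
    then show ?thesis using 3 switch[of p1' p2' d] by simp
  next
    case 4
    then have "potential z x c d = potential z x q1 q2" using potential_commute by metis
    then show ?thesis using 4 switch[of p2' p1' d] sym[of p1' p2'] by simp
  qed
qed

section \<open>The algorithm driven by a stream of coins\<close>

type_synonym 'a state = "'a \<times> 'a \<times> 'a"

fun state_config :: "'a state \<Rightarrow> 'a config" where
  "state_config (t, z, x) = {#t, z, x#}"

text \<open>Here \<open>r\<close> is the drop-off point alone; the pickup point enters through
  \<open>move_cost\<close> and the probabilities.\<close>

fun taxi_move :: "'a state \<Rightarrow> 'a \<Rightarrow> bool \<Rightarrow> bool \<Rightarrow> 'a move" where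
  "taxi_move (t, z, x) r switch explore =
    (let z' = (if switch then t else z); u = (if switch then z else t) in
      if explore then Move (x, r) {#(z', z'), (u, u)#} else Move (u, r) {#(z', z'), (x, x)#})"

fun next_state :: "'a state \<Rightarrow> 'a \<Rightarrow> bool \<Rightarrow> bool \<Rightarrow> 'a state" where
  "next_state (t, z, x) r switch explore =
    (let z' = (if switch then t else z); u = (if switch then z else t) in
      (r, z', if explore then u else x))"

fun switch_prob :: "'a::metric_space state \<Rightarrow> 'a \<Rightarrow> real" where
  "switch_prob (t, z, x) s = belief_prob (dist t s) (dist z s)"

fun third_prob :: "'a::metric_space state \<Rightarrow> 'a \<Rightarrow> real" where
  "third_prob (t, z, x) s = explore_prob (min (dist t s) (dist z s)) (dist x s)"

lemma config_before_taxi_move: "config_before (taxi_move S r i j) = state_config S"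
  by (cases S) (auto simp: config_before_def Let_def add_mset_commute)

lemma config_after_taxi_move: "config_after (taxi_move S r i j) = state_config (next_state S r i j)"
  by (cases S) (auto simp: config_after_def Let_def add_mset_commute)

lemma prob_bounds:
  "0 \<le> switch_prob S s" "switch_prob S s \<le> 1" "0 \<le> third_prob S s" "third_prob S s \<le> 1"
  by (cases S; simp add: belief_prob_bounds explore_prob_bounds)+

fun play :: "'a::metric_space state \<Rightarrow> 'a request list \<Rightarrow> real stream \<Rightarrow> 'a move list" where
  "play S [] \<omega> = []"
| "play S (r # rs) \<omega> =
    (let i = shd \<omega> < switch_prob S (fst r); j = shd (stl \<omega>) < third_prob S (fst r) in
      taxi_move S (snd r) i j # play (next_state S (snd r) i j) rs (stl (stl \<omega>)))"

lemma length_play [simp]: "length (play S \<sigma> \<omega>) = length \<sigma>"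
  by (induction S \<sigma> \<omega> rule: play.induct) (simp_all add: Let_def)

text \<open>No move depends on later requests, which is what makes the strategy online.\<close>

lemma play_take: "play S (take n \<sigma>) \<omega> = take n (play S \<sigma> \<omega>)"
  by (induction S \<sigma> \<omega> arbitrary: n rule: play.induct) (simp, case_tac n, simp_all add: Let_def)

lemma serves_play: "serves (state_config S) \<sigma> (play S \<sigma> \<omega>)"
  by (induction S \<sigma> \<omega> rule: play.induct)
    (simp_all add: Let_def config_before_taxi_move config_after_taxi_move)

lemma total_cost_Nil [simp]: "total_cost [] ms = 0"
  by (simp add: total_cost_def)

lemma total_cost_Cons [simp]: "total_cost (r # \<sigma>) (m # ms) = move_cost r m + total_cost \<sigma> ms"
  by (simp add: total_cost_def)

lemma move_cost_nonneg: "0 \<le> move_cost r m"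
proof -
  have "0 \<le> (\<Sum>(p, q)\<in>#P. dist p q)" for P :: "('a \<times> 'a) multiset"
    by (induction P) (auto split: prod.split)
  then show ?thesis by (simp add: move_cost_def)
qed

lemma total_cost_nonneg: "0 \<le> total_cost \<sigma> ms"
  by (auto simp: total_cost_def intro!: sum_list_nonneg move_cost_nonneg)

text \<open>Any order will do, since each starts with potential zero.\<close>

definition init_state :: "'a config \<Rightarrow> 'a state" where
  "init_state C = (SOME S. state_config S = C)"

lemma state_config_init_state:
  assumes "size C = 3"
  shows "state_config (init_state C) = C"
proof -
  obtain a b c where "C = {#a, b, c#}"
    using assms unfolding numeral_3_eq_3 by (metis size_eq_Suc_imp_eq_union size_add_mset
      nat.inject size_eq_0_iff_empty)
  then have "state_config (a, b, c) = C" by simp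
  then show ?thesis unfolding init_state_def by (rule someI)
qed

text \<open>The state is recovered by replaying the revealed requests with the same coins.\<close>

definition random_strategy :: "real stream \<Rightarrow> 'a::metric_space strategy" where
  "random_strategy \<omega> C \<sigma> = last (play (init_state C) \<sigma> \<omega>)"

lemma strategy_moves_random_strategy:
  "strategy_moves (random_strategy \<omega>) C \<sigma> = play (init_state C) \<sigma> \<omega>"
proof (rule nth_equalityI)
  fix i assume "i < length (strategy_moves (random_strategy \<omega>) C \<sigma>)"
  then have i: "i < length \<sigma>" by (simp add: strategy_moves_def)
  then have "play (init_state C) (take (Suc i) \<sigma>) \<omega> \<noteq> []"
    by (metis length_play length_0_conv take_eq_Nil list.size(3) not_less_zero nat.distinct(1))
  then show "strategy_moves (random_strategy \<omega>) C \<sigma> ! i = play (init_state C) \<sigma> \<omega> ! i"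
    using i by (simp add: strategy_moves_def random_strategy_def play_take last_conv_nth)
qed (simp add: strategy_moves_def)

section \<open>Integration over the coins\<close>

definition coin :: "real measure" where
  "coin = uniform_measure lborel {0..1}"

lemma space_coin [simp]: "space coin = UNIV" and sets_coin [simp, measurable_cong]: "sets coin = sets borel"
  by (simp_all add: coin_def)

lemma prob_space_coin: "prob_space coin"
  unfolding coin_def by (rule prob_space_uniform_measure) auto

interpretation coin: prob_space coin
  by (rule prob_space_coin)

lemma emeasure_coin_less:
  assumes "0 \<le> p" "p \<le> 1"
  shows "emeasure coin {..<p} = ennreal p"
proof -
  have "{0..1} \<inter> {..<p} = {0..<p}" using assms by auto
  then show ?thesis using assms by (simp add: coin_def divide_ennreal_def)
qed

lemma emeasure_coin_not_less:
  assumes "0 \<le> p" "p \<le> 1"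
  shows "emeasure coin {p..} = ennreal (1 - p)"
proof -
  have "{0..1} \<inter> {p..} = {p..1}" using assms by auto
  then show ?thesis using assms by (simp add: coin_def divide_ennreal_def)
qed

text \<open>Head and tail of the stream are independent, so the integral splits by the value of the
  head.\<close>

lemma nn_integral_flip:
  assumes p: "0 \<le> p" "p \<le> 1"
    and [measurable]: "f \<in> borel_measurable (stream_space coin)" "g \<in> borel_measurable (stream_space coin)"
  shows "(\<integral>\<^sup>+\<omega>. (if shd \<omega> < p then f (stl \<omega>) else g (stl \<omega>)) \<partial>stream_space coin) =
    ennreal p * (\<integral>\<^sup>+\<omega>. f \<omega> \<partial>stream_space coin) + ennreal (1 - p) * (\<integral>\<^sup>+\<omega>. g \<omega> \<partial>stream_space coin)"
    (is "?L = ennreal p * ?F + ennreal (1 - p) * ?G")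
proof -
  have "?L = (\<integral>\<^sup>+u. \<integral>\<^sup>+\<omega>. (if u < p then f \<omega> else g \<omega>) \<partial>stream_space coin \<partial>coin)"
    by (subst coin.nn_integral_stream_space) (simp_all cong: if_cong)
  also have "\<dots> = (\<integral>\<^sup>+u. ?F * indicator {..<p} u + ?G * indicator {p..} u \<partial>coin)"
    by (intro nn_integral_cong) (auto split: split_indicator)
  also have "\<dots> = ?F * emeasure coin {..<p} + ?G * emeasure coin {p..}"
    by (subst nn_integral_add) (auto simp: nn_integral_cmult_indicator)
  finally show ?thesis
    using p by (simp add: emeasure_coin_less emeasure_coin_not_less mult.commute)
qed

lemma measurable_total_cost_play [measurable]:
  "(\<lambda>\<omega>. total_cost \<sigma> (play S \<sigma> \<omega>)) \<in> borel_measurable (stream_space coin)"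
proof (induction \<sigma> arbitrary: S)
  case (Cons r \<sigma>)
  note [measurable] = Cons.IH
  define f where "f i j \<omega> = move_cost r (taxi_move S (snd r) i j)
    + total_cost \<sigma> (play (next_state S (snd r) i j) \<sigma> \<omega>)" for i j \<omega>
  have [measurable]: "f i j \<in> borel_measurable (stream_space coin)" for i j
    unfolding f_def by measurable
  have "(\<lambda>\<omega>. total_cost (r # \<sigma>) (play S (r # \<sigma>) \<omega>)) =
    (\<lambda>\<omega>. if shd \<omega> < switch_prob S (fst r)
      then if shd (stl \<omega>) < third_prob S (fst r) then f True True (stl (stl \<omega>)) else f True False (stl (stl \<omega>))
      else if shd (stl \<omega>) < third_prob S (fst r) then f False True (stl (stl \<omega>)) else f False False (stl (stl \<omega>)))"
    by (auto simp: Let_def f_def)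
  also have "\<dots> \<in> borel_measurable (stream_space coin)" by measurable
  finally show ?case .
qed simp

definition expected_cost :: "'a::metric_space state \<Rightarrow> 'a request list \<Rightarrow> ennreal" where
  "expected_cost S \<sigma> = (\<integral>\<^sup>+\<omega>. ennreal (total_cost \<sigma> (play S \<sigma> \<omega>)) \<partial>stream_space coin)"

definition expected_after :: "'a::metric_space state \<Rightarrow> 'a request \<Rightarrow> 'a request list \<Rightarrow> bool \<Rightarrow> bool \<Rightarrow> ennreal" where
  "expected_after S r \<sigma> i j = ennreal (move_cost r (taxi_move S (snd r) i j))
    + expected_cost (next_state S (snd r) i j) \<sigma>"

lemma expected_cost_Nil [simp]: "expected_cost S [] = 0"
  by (simp add: expected_cost_def)

lemma expected_cost_Cons:
  "expected_cost S (r # \<sigma>) =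
    (let p = switch_prob S (fst r); q = third_prob S (fst r) in
      ennreal p * (ennreal q * expected_after S r \<sigma> True True + ennreal (1 - q) * expected_after S r \<sigma> True False)
      + ennreal (1 - p) * (ennreal q * expected_after S r \<sigma> False True + ennreal (1 - q) * expected_after S r \<sigma> False False))"
proof -
  interpret S: prob_space "stream_space coin" by (rule coin.prob_space_stream_space)
  define f where "f i j \<omega> = ennreal (move_cost r (taxi_move S (snd r) i j)
    + total_cost \<sigma> (play (next_state S (snd r) i j) \<sigma> \<omega>))" for i j \<omega>
  have [measurable]: "f i j \<in> borel_measurable (stream_space coin)" for i j
    unfolding f_def by measurable
  have f: "(\<integral>\<^sup>+\<omega>. f i j \<omega> \<partial>stream_space coin) = expected_after S r \<sigma> i j" for i j
    unfolding f_def expected_after_def expected_cost_def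
    by (simp add: nn_integral_add move_cost_nonneg total_cost_nonneg S.emeasure_space_1)
  have "expected_cost S (r # \<sigma>) = (\<integral>\<^sup>+\<omega>. (if shd \<omega> < switch_prob S (fst r)
      then (\<lambda>\<omega>. if shd \<omega> < third_prob S (fst r) then f True True (stl \<omega>) else f True False (stl \<omega>)) (stl \<omega>)
      else (\<lambda>\<omega>. if shd \<omega> < third_prob S (fst r) then f False True (stl \<omega>) else f False False (stl \<omega>)) (stl \<omega>)) \<partial>stream_space coin)"
    unfolding expected_cost_def by (intro nn_integral_cong) (auto simp: Let_def f_def)
  also have "\<dots> = (let p = switch_prob S (fst r); q = third_prob S (fst r) in
      ennreal p * (ennreal q * expected_after S r \<sigma> True True + ennreal (1 - q) * expected_after S r \<sigma> True False)
      + ennreal (1 - p) * (ennreal q * expected_after S r \<sigma> False True + ennreal (1 - q) * expected_after S r \<sigma> False False))"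
    unfolding Let_def by (subst nn_integral_flip, (simp add: prob_bounds)+)
      (simp add: nn_integral_flip prob_bounds f)
  finally show ?thesis .
qed

section \<open>Comparison with an offline schedule\<close>

lemma ennreal_mix_le:
  assumes "0 \<le> p" "p \<le> 1" "v \<le> ennreal v'" "w \<le> ennreal w'" "0 \<le> v'" "0 \<le> w'"
  shows "ennreal p * v + ennreal (1 - p) * w \<le> ennreal (mix p v' w')"
proof -
  have "ennreal p * v + ennreal (1 - p) * w \<le> ennreal p * ennreal v' + ennreal (1 - p) * ennreal w'"
    using assms by (intro add_mono mult_left_mono) auto
  also have "\<dots> = ennreal (mix p v' w')"
    using assms by (simp add: mix_def ennreal_plus ennreal_mult)
  finally show ?thesis .
qed

lemma mix_nonneg: "0 \<le> p \<Longrightarrow> p \<le> 1 \<Longrightarrow> 0 \<le> v \<Longrightarrow> 0 \<le> w \<Longrightarrow> 0 \<le> mix p v w"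
  by (simp add: mix_def)

lemma serves_Cons_cases:
  assumes "serves {#y, q1, q2#} (r # \<sigma>) ms"
  obtains c y' p1 p1' p2 p2' ms' where
    "ms = Move (c, y') {#(p1, p1'), (p2, p2')#} # ms'"
    "{#c, p1, p2#} = {#y, q1, q2#}" "serves {#y', p1', p2'#} \<sigma> ms'"
proof -
  from assms obtain m ms' where ms: "ms = m # ms'" and b: "config_before m = {#y, q1, q2#}"
    and s: "serves (config_after m) \<sigma> ms'"
    by (cases ms) auto
  obtain c y' P where m: "m = Move (c, y') P" by (metis move.exhaust surj_pair)
  from b have "size (add_mset c (image_mset fst P)) = 3" unfolding m config_before_def by simp
  then have "size P = 2" by simp
  then obtain p1 p1' p2 p2' where P: "P = {#(p1, p1'), (p2, p2')#}"
    unfolding numeral_2_eq_2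
    by (metis size_eq_Suc_imp_eq_union size_add_mset nat.inject size_eq_0_iff_empty surj_pair)
  show thesis
    using that ms b s unfolding m P by (auto simp: config_before_def config_after_def)
qed

text \<open>
  The offline taxi that dropped off the last passenger is at \<open>y\<close>, but the potential pretends that
  it is still at \<open>t\<close> and charges its way to \<open>y\<close> to the next request. The induction runs
  over the remaining requests, so that the strategy's coins are integrated out from the front.
\<close>

lemma expected_cost_le:
  assumes "serves {#y, q1, q2#} \<sigma> ms"
  shows "expected_cost (t, z, x) \<sigma> \<le>
    ennreal (potential z x q1 q2 + 2000 * (dist t y + total_cost \<sigma> ms))"
  using assms
proof (induction \<sigma> arbitrary: y q1 q2 t z x ms)
  case Nil
  then show ?case by simp
next
  case (Cons r \<sigma>)
  obtain s t' where r: "r = (s, t')" by (cases r)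
  from Cons.prems obtain c y' p1 p1' p2 p2' ms' where
    ms: "ms = Move (c, y') {#(p1, p1'), (p2, p2')#} # ms'" and
    before: "{#c, p1, p2#} = {#y, q1, q2#}" and srv: "serves {#y', p1', p2'#} \<sigma> ms'"
    by (rule serves_Cons_cases)
  \<comment> \<open>The later offline cost is the same for all coin outcomes, as the offline
    schedule is fixed.\<close>
  define K where "K = 2000 * (dist t' y' + total_cost \<sigma> ms')"
  have K: "0 \<le> K" by (simp add: K_def total_cost_nonneg)
  have IH: "expected_cost (t', z', x') \<sigma> \<le> ennreal (potential z' x' p1' p2' + K)" for z' x'
    using Cons.IH[OF srv] unfolding K_def .
  have after: "ennreal d + expected_cost (t', z', x') \<sigma> \<le> ennreal (d + potential z' x' p1' p2' + K)"
    if "0 \<le> d" for d z' x'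
  proof -
    have "ennreal d + expected_cost (t', z', x') \<sigma> \<le> ennreal d + ennreal (potential z' x' p1' p2' + K)"
      by (intro add_left_mono IH)
    then show ?thesis using that K by (simp add: potential_nonneg add.assoc flip: ennreal_plus)
  qed
  \<comment> \<open>\<open>mix_add\<close> moves \<open>K\<close> into the four leaves of
    \<open>expected_step\<close>, one for each outcome of the two coins.\<close>
  have "expected_cost (t, z, x) (r # \<sigma>) \<le> ennreal (expected_step t z x s p1' p2' + K)"
    unfolding expected_cost_Cons expected_after_def r Let_def expected_step_def
    unfolding mix_add[symmetric]
    by (simp add: move_cost_def Let_def)
      (intro ennreal_mix_le after mix_nonneg add_nonneg_nonneg potential_nonneg zero_le_dist K
        belief_prob_bounds explore_prob_bounds; simp)+
  also have "expected_step t z x s p1' p2' + K \<le> potential z x q1 q2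
      + 2000 * (dist t y + dist c s + dist p1 p1' + dist p2 p2') + K"
    using offline_step[OF before] by simp
  also have "\<dots> = potential z x q1 q2 + 2000 * (dist t y + total_cost (r # \<sigma>) ms)"
    unfolding ms r K_def by (simp add: move_cost_def)
  finally show ?case by (simp add: ennreal_leI)
qed

text \<open>Both algorithms start from the same points, so the initial potential is zero and no
  additive constant remains.\<close>

lemma expected_cost_le_OPT:
  "expected_cost S \<sigma> \<le> ennreal (2000 * OPT (state_config S) \<sigma>)"
proof -
  obtain t z x where S: "S = (t, z, x)" by (cases S)
  have le: "expected_cost S \<sigma> \<le> ennreal (2000 * total_cost \<sigma> ms)" if "serves (state_config S) \<sigma> ms" for ms
  proof -
    have "potential z x z x = 0" by (simp add: potential_def matching_def belief_error_def)
    then show ?thesis using expected_cost_le[of t z x \<sigma> ms t z x] that by (simp add: S)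
  qed
  let ?M = "{ms. serves (state_config S) \<sigma> ms}"
  have ne: "?M \<noteq> {}" using serves_play by blast
  \<comment> \<open>Finiteness turns the expected cost into a real, so that the bound passes to the
    infimum.\<close>
  have fin: "expected_cost S \<sigma> < \<top>"
    using le[OF serves_play] by (metis ennreal_less_top le_less_trans)
  then obtain e where e: "expected_cost S \<sigma> = ennreal e" "0 \<le> e"
    by (cases "expected_cost S \<sigma>") auto
  have "e / 2000 \<le> OPT (state_config S) \<sigma>" unfolding OPT_def
  proof (rule cINF_greatest[OF ne])
    fix ms assume "ms \<in> ?M"
    then have "ennreal e \<le> ennreal (2000 * total_cost \<sigma> ms)" using le e by simp
    then show "e / 2000 \<le> total_cost \<sigma> ms"
      using e total_cost_nonneg[of \<sigma> ms] by (simp add: ennreal_le_iff)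
  qed
  then show ?thesis using e by (simp add: ennreal_leI)
qed

section \<open>The distribution over strategies\<close>

text \<open>
  Strategies carry no natural sigma-algebra; this is the largest one on the range that makes
  \<open>random_strategy\<close> measurable.
\<close>

definition strategy_algebra :: "'a::metric_space strategy measure" where
  "strategy_algebra = sigma (range random_strategy)
    {B. B \<subseteq> range random_strategy \<and> random_strategy -` B \<in> sets (stream_space coin)}"

definition strategy_measure :: "'a::metric_space strategy measure" where
  "strategy_measure = distr (stream_space coin) strategy_algebra random_strategy"

lemma space_coins [simp]: "space (stream_space coin) = UNIV"
  by (simp add: space_stream_space)

lemma space_strategy_algebra [simp]: "space strategy_algebra = range random_strategy"
  unfolding strategy_algebra_def by (rule space_measure_of) auto

lemma sets_strategy_algebraI:
  "B \<subseteq> range random_strategy \<Longrightarrow> random_strategy -` B \<in> sets (stream_space coin) \<Longrightarrow>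
    B \<in> sets strategy_algebra"
  unfolding strategy_algebra_def by (rule in_measure_of) auto

lemma measurable_random_strategy [measurable]:
  "random_strategy \<in> measurable (stream_space coin) strategy_algebra"
  unfolding strategy_algebra_def by (rule measurable_measure_of) auto

lemma space_strategy_measure: "space strategy_measure = range random_strategy"
  by (simp add: strategy_measure_def)

lemma strategy_cost_random_strategy:
  "strategy_cost (random_strategy \<omega>) C \<sigma> = total_cost \<sigma> (play (init_state C) \<sigma> \<omega>)"
  by (simp add: strategy_cost_def strategy_moves_random_strategy)

text \<open>Composed with \<open>random_strategy\<close> the cost is that of \<open>play\<close>,
  which is measurable in the coins.\<close>

lemma measurable_strategy_cost [measurable]:
  "(\<lambda>A. strategy_cost A C \<sigma>) \<in> borel_measurable strategy_algebra"
proof (rule measurableI)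
  fix X :: "real set" assume [measurable]: "X \<in> sets borel"
  let ?B = "(\<lambda>A. strategy_cost A C \<sigma>) -` X \<inter> range random_strategy"
  have "random_strategy -` ?B =
      (\<lambda>\<omega>. total_cost \<sigma> (play (init_state C) \<sigma> \<omega>)) -` X \<inter> space (stream_space coin)"
    unfolding strategy_cost_random_strategy[symmetric] by auto
  also have "\<dots> \<in> sets (stream_space coin)" by measurable
  finally show "(\<lambda>A. strategy_cost A C \<sigma>) -` X \<inter> space strategy_algebra \<in> sets strategy_algebra"
    unfolding space_strategy_algebra by (intro sets_strategy_algebraI) auto
qed simp

lemma online_algorithm_strategy_measure: "online_algorithm 3 strategy_measure"
proof -
  interpret prob_space "stream_space coin" by (rule coin.prob_space_stream_space)
  have "prob_space strategy_measure"
    unfolding strategy_measure_def by (rule prob_space_distr) measurable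
  moreover have "deterministic_online_algorithm 3 (random_strategy \<omega>)" for \<omega>
    unfolding deterministic_online_algorithm_def strategy_moves_random_strategy
    by (metis serves_play state_config_init_state)
  moreover have "(\<lambda>A. strategy_cost A C \<sigma>) \<in> borel_measurable strategy_measure" for C \<sigma>
    unfolding strategy_measure_def by measurable
  ultimately show ?thesis
    unfolding online_algorithm_def space_strategy_measure by blast
qed

lemma competitive_strategy_measure: "competitive 3 2000 strategy_measure"
proof -
  have "integrable strategy_measure (\<lambda>A. strategy_cost A C \<sigma>) \<and>
      (\<integral>A. strategy_cost A C \<sigma> \<partial>strategy_measure) \<le> 2000 * OPT C \<sigma> + 0" if C: "size C = 3" for C \<sigma>
  proof -
    have nn: "0 \<le> strategy_cost A C \<sigma>" for A by (simp add: strategy_cost_def total_cost_nonneg)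
    have [measurable]: "(\<lambda>A. strategy_cost A C \<sigma>) \<in> borel_measurable strategy_measure"
      unfolding strategy_measure_def by measurable
    have "(\<integral>\<^sup>+A. ennreal (strategy_cost A C \<sigma>) \<partial>strategy_measure) = expected_cost (init_state C) \<sigma>"
      unfolding expected_cost_def strategy_cost_random_strategy[symmetric] strategy_measure_def
      by (rule nn_integral_distr) measurable
    also have "\<dots> \<le> ennreal (2000 * OPT C \<sigma>)"
      using expected_cost_le_OPT[of "init_state C" \<sigma>] by (simp add: state_config_init_state[OF C])
    finally have le: "(\<integral>\<^sup>+A. ennreal (strategy_cost A C \<sigma>) \<partial>strategy_measure) \<le> ennreal (2000 * OPT C \<sigma>)" .
    have int: "integrable strategy_measure (\<lambda>A. strategy_cost A C \<sigma>)"
      using le nn by (intro integrableI_nonneg) (auto intro: le_less_trans)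
    \<comment> \<open>\<open>ennreal\<close> sends negative reals to 0, so the sign is needed to
      return to a real inequality.\<close>
    have "0 \<le> OPT C \<sigma>" unfolding OPT_def
      using serves_play[of "init_state C"] state_config_init_state[OF C]
      by (intro cINF_greatest) (auto simp: total_cost_nonneg)
    then show ?thesis
      using int le nn by (simp add: nn_integral_eq_integral integral_nonneg ennreal_le_iff)
  qed
  then show ?thesis unfolding competitive_def by blast
qed

theorem theorem5:
  "\<exists>(\<rho>::real) (\<A> :: real strategy measure). online_algorithm 3 \<A> \<and> competitive 3 \<rho> \<A>"
  using online_algorithm_strategy_measure competitive_strategy_measure by blast

end
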